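(* Let $\alpha\colon U\subset\mathbb{R}^2\to S\subset\mathbb{R}^3$ be a local parametrization of a smooth surface $S$ without Euclidean parabolic points, with co-normal map $\nu$ and corresponding co-normal surface $S^{\nu}$ (parametrized by $\nu$). A point $p\in S$ is an affine cusp of Gauss of $S$ if and only if the point $\nu(p)\in S^{\nu}$ is a cusp of Gauss of $S^{\nu}$.
   Context: For an immersion $\alpha\colon U\to\mathbb{R}^3$ put $L=\det(\alpha_u,\alpha_v,\alpha_{uu})$, $M=\det(\alpha_u,\alpha_v,\alpha_{uv})$, $N=\det(\alpha_u,\alpha_v,\alpha_{vv})$. A point is Euclidean parabolic if $LN-M^2=0$ there. At non-parabolic points the co-normal vector is $\nu=|LN-M^2|^{-1/4}\,(\alpha_u\wedge\alpha_v)$. The affine normal $\xi$ is determined by $\langle\nu,\xi\rangle=1$ and $\langle\xi,\nu_u\rangle=\langle\xi,\nu_v\rangle=0$; its derivatives are tangent to $S$. The affine third fundamental form is $\mathrm{III}^{\mathrm{aff}}_\alpha(w)=\langle D\nu(w),D\xi(w)\rangle=l\,a^2+2m\,ab+n\,b^2$ for $w=a\alpha_u+b\alpha_v$, with $l=\langle\nu_u,\xi_u\rangle$, $m=\langle\nu_u,\xi_v\rangle$, $n=\langle\nu_v,\xi_v\rangle$. A nonzero tangent vector $w$ is an affine asymptotic direction if $\mathrm{III}^{\mathrm{aff}}_\alpha(w)=0$. The affine parabolic set is $\{ln-m^2=0\}$. The co-normal map is an immersion, so $S^\nu$ is locally a regular surface. A point $p$ of the affine parabolic set, near which this set is a regular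 curve and at which there is a unique affine asymptotic direction, is an affine cusp of Gauss if that direction is tangent to the affine parabolic set at $p$. Analogously, a (Euclidean) parabolic point of a surface, near which the parabolic set (zero Gaussian curvature) is a regular curve and at which there is a unique (Euclidean) asymptotic direction, is a cusp of Gauss if that asymptotic direction is tangent to the parabolic set. *)

theory Defs
  imports "HOL-Analysis.Analysis"
begin

section \<open>Smooth maps and local parametrizations\<close>

text \<open>Used on open sets only; all values of \<^term>\<open>v\<close> together amount to all partial derivatives.\<close>

primrec Ck_on :: "nat \<Rightarrow> ('a::euclidean_space \<Rightarrow> 'b::euclidean_space) \<Rightarrow> 'a set \<Rightarrow> bool" where
  "Ck_on 0 f U \<longleftrightarrow> continuous_on U f"
| "Ck_on (Suc k) f U \<longleftrightarrow>
     (\<forall>x\<in>U. f differentiable at x) \<and> (\<forall>v. Ck_on k (\<lambda>x. frechet_derivative f (at x) v) U)"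

definition smooth_on :: "('a::euclidean_space \<Rightarrow> 'b::euclidean_space) \<Rightarrow> 'a set \<Rightarrow> bool" where
  "smooth_on f U \<longleftrightarrow> (\<forall>k. Ck_on k f U)"

definition du :: "(real \<times> real \<Rightarrow> 'b::euclidean_space) \<Rightarrow> real \<times> real \<Rightarrow> 'b" where
  "du f q = frechet_derivative f (at q) (1, 0)"

definition dv :: "(real \<times> real \<Rightarrow> 'b::euclidean_space) \<Rightarrow> real \<times> real \<Rightarrow> 'b" where
  "dv f q = frechet_derivative f (at q) (0, 1)"

definition local_parametrization ::
    "(real \<times> real \<Rightarrow> real^3) \<Rightarrow> (real \<times> real) set \<Rightarrow> (real^3) set \<Rightarrow> bool" where
  "local_parametrization \<alpha> U S \<longleftrightarrow>
     open U \<and> smooth_on \<alpha> U \<and> (\<forall>q\<in>U. inj (frechet_derivative \<alpha> (at q))) \<and>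
     openin (top_of_set S) (\<alpha> ` U) \<and> (\<exists>g. homeomorphism U (\<alpha> ` U) \<alpha> g)"

definition smooth_surface :: "(real^3) set \<Rightarrow> bool" where
  "smooth_surface S \<longleftrightarrow> (\<forall>p\<in>S. \<exists>\<alpha> U. local_parametrization \<alpha> U S \<and> p \<in> \<alpha> ` U)"


section \<open>Euclidean notions\<close>

definition det3 :: "real^3 \<Rightarrow> real^3 \<Rightarrow> real^3 \<Rightarrow> real" where
  "det3 a b c = det (vector [a, b, c] :: real^3^3)"

definition coeff_L :: "(real \<times> real \<Rightarrow> real^3) \<Rightarrow> real \<times> real \<Rightarrow> real" where
  "coeff_L \<beta> q = det3 (du \<beta> q) (dv \<beta> q) (du (du \<beta>) q)"

definition coeff_M :: "(real \<times> real \<Rightarrow> real^3) \<Rightarrow> real \<times> real \<Rightarrow> real" where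
  "coeff_M \<beta> q = det3 (du \<beta> q) (dv \<beta> q) (dv (du \<beta>) q)"

definition coeff_N :: "(real \<times> real \<Rightarrow> real^3) \<Rightarrow> real \<times> real \<Rightarrow> real" where
  "coeff_N \<beta> q = det3 (du \<beta> q) (dv \<beta> q) (dv (dv \<beta>) q)"

definition LN_M2 :: "(real \<times> real \<Rightarrow> real^3) \<Rightarrow> real \<times> real \<Rightarrow> real" where
  "LN_M2 \<beta> q = coeff_L \<beta> q * coeff_N \<beta> q - (coeff_M \<beta> q)\<^sup>2"

definition parabolic_set ::
    "(real \<times> real \<Rightarrow> real^3) \<Rightarrow> (real \<times> real) set \<Rightarrow> (real \<times> real) set" where
  "parabolic_set \<beta> U = {q \<in> U. LN_M2 \<beta> q = 0}"

text \<open>The second fundamental form at \<open>a \<beta>\<^sub>u + b \<beta>\<^sub>v\<close>. Dividing the determinants by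
  \<open>|\<beta>\<^sub>u \<and> \<beta>\<^sub>v|\<close> turns them into the products of the second derivatives with the unit normal;
  the Gaussian curvature is accordingly \<^term>\<open>LN_M2 \<beta> q\<close> divided by \<open>|\<beta>\<^sub>u \<and> \<beta>\<^sub>v|\<close> to the
  fourth power.\<close>

definition second_form :: "(real \<times> real \<Rightarrow> real^3) \<Rightarrow> real \<times> real \<Rightarrow> real \<Rightarrow> real \<Rightarrow> real" where
  "second_form \<beta> q a b =
     (coeff_L \<beta> q * a\<^sup>2 + 2 * coeff_M \<beta> q * a * b + coeff_N \<beta> q * b\<^sup>2)
       / norm (cross3 (du \<beta> q) (dv \<beta> q))"

definition asymptotic_direction ::
    "(real \<times> real \<Rightarrow> real^3) \<Rightarrow> real \<times> real \<Rightarrow> real^3 \<Rightarrow> bool" where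
  "asymptotic_direction \<beta> q w \<longleftrightarrow>
     w \<noteq> 0 \<and> (\<exists>a b. w = a *\<^sub>R du \<beta> q + b *\<^sub>R dv \<beta> q \<and> second_form \<beta> q a b = 0)"


section \<open>Affine notions\<close>

definition conormal :: "(real \<times> real \<Rightarrow> real^3) \<Rightarrow> real \<times> real \<Rightarrow> real^3" where
  "conormal \<alpha> q = (\<bar>LN_M2 \<alpha> q\<bar> powr (- 1 / 4)) *\<^sub>R cross3 (du \<alpha> q) (dv \<alpha> q)"

definition affine_normal :: "(real \<times> real \<Rightarrow> real^3) \<Rightarrow> real \<times> real \<Rightarrow> real^3" where
  "affine_normal \<alpha> q =
     (THE \<xi>. conormal \<alpha> q \<bullet> \<xi> = 1 \<and> \<xi> \<bullet> du (conormal \<alpha>) q = 0 \<and> \<xi> \<bullet> dv (conormal \<alpha>) q = 0)"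

definition coeff_l :: "(real \<times> real \<Rightarrow> real^3) \<Rightarrow> real \<times> real \<Rightarrow> real" where
  "coeff_l \<alpha> q = du (conormal \<alpha>) q \<bullet> du (affine_normal \<alpha>) q"

definition coeff_m :: "(real \<times> real \<Rightarrow> real^3) \<Rightarrow> real \<times> real \<Rightarrow> real" where
  "coeff_m \<alpha> q = du (conormal \<alpha>) q \<bullet> dv (affine_normal \<alpha>) q"

definition coeff_n :: "(real \<times> real \<Rightarrow> real^3) \<Rightarrow> real \<times> real \<Rightarrow> real" where
  "coeff_n \<alpha> q = dv (conormal \<alpha>) q \<bullet> dv (affine_normal \<alpha>) q"

definition affine_parabolic_set ::
    "(real \<times> real \<Rightarrow> real^3) \<Rightarrow> (real \<times> real) set \<Rightarrow> (real \<times> real) set" where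
  "affine_parabolic_set \<alpha> U = {q \<in> U. coeff_l \<alpha> q * coeff_n \<alpha> q - (coeff_m \<alpha> q)\<^sup>2 = 0}"

text \<open>The value of the affine third fundamental form at \<open>a \<alpha>\<^sub>u + b \<alpha>\<^sub>v\<close>; it equals
  \<open>l a\<^sup>2 + 2 m a b + n b\<^sup>2\<close> because \<open>\<langle>\<nu>\<^sub>u, \<xi>\<^sub>v\<rangle> = \<langle>\<nu>\<^sub>v, \<xi>\<^sub>u\<rangle>\<close>.\<close>

definition affine_third_form ::
    "(real \<times> real \<Rightarrow> real^3) \<Rightarrow> real \<times> real \<Rightarrow> real \<Rightarrow> real \<Rightarrow> real" where
  "affine_third_form \<alpha> q a b =
     frechet_derivative (conormal \<alpha>) (at q) (a, b)
       \<bullet> frechet_derivative (affine_normal \<alpha>) (at q) (a, b)"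

definition affine_asymptotic_direction ::
    "(real \<times> real \<Rightarrow> real^3) \<Rightarrow> real \<times> real \<Rightarrow> real^3 \<Rightarrow> bool" where
  "affine_asymptotic_direction \<alpha> q w \<longleftrightarrow>
     w \<noteq> 0 \<and> (\<exists>a b. w = a *\<^sub>R du \<alpha> q + b *\<^sub>R dv \<alpha> q \<and> affine_third_form \<alpha> q a b = 0)"


section \<open>Cusps of Gauss\<close>

text \<open>Surfaces are given by parametrizations, and curves on them by their preimages in the
  parameter domain; a point of the surface is named by its parameter \<open>q\<close>. This keeps the notions
  meaningful for an immersion (such as the co-normal map) that need not be injective.
  The next predicate says that \<open>C\<close> is a regular curve near \<open>q\<close>, with local
  parametrization \<open>\<gamma>\<close>.\<close>

definition regular_curve_near ::
    "(real \<times> real) set \<Rightarrow> real \<times> real \<Rightarrow> (real \<Rightarrow> real \<times> real) \<Rightarrow> bool" where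
  "regular_curve_near C q \<gamma> \<longleftrightarrow>
     (\<exists>\<epsilon>>0. \<exists>W g. open W \<and> homeomorphism {-\<epsilon><..<\<epsilon>} (C \<inter> W) \<gamma> g \<and>
        smooth_on \<gamma> {-\<epsilon><..<\<epsilon>} \<and> (\<forall>t\<in>{-\<epsilon><..<\<epsilon>}. vector_derivative \<gamma> (at t) \<noteq> 0) \<and> \<gamma> 0 = q)"

text \<open>A direction is a nonzero vector up to scaling, so uniqueness of a direction \<open>w\<close> means that
  all others lie in the line spanned by \<open>w\<close>.\<close>

definition cusp_of_Gauss ::
    "(real \<times> real \<Rightarrow> real^3) \<Rightarrow> (real \<times> real) set \<Rightarrow> real \<times> real \<Rightarrow> bool" where
  "cusp_of_Gauss \<beta> U q \<longleftrightarrow> q \<in> parabolic_set \<beta> U \<and>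
     (\<exists>\<gamma> w. regular_curve_near (parabolic_set \<beta> U) q \<gamma> \<and>
        asymptotic_direction \<beta> q w \<and>
        (\<forall>w'. asymptotic_direction \<beta> q w' \<longrightarrow> w' \<in> span {w}) \<and>
        w \<in> span {vector_derivative (\<beta> \<circ> \<gamma>) (at 0)})"

definition affine_cusp_of_Gauss ::
    "(real \<times> real \<Rightarrow> real^3) \<Rightarrow> (real \<times> real) set \<Rightarrow> real \<times> real \<Rightarrow> bool" where
  "affine_cusp_of_Gauss \<alpha> U q \<longleftrightarrow> q \<in> affine_parabolic_set \<alpha> U \<and>
     (\<exists>\<gamma> w. regular_curve_near (affine_parabolic_set \<alpha> U) q \<gamma> \<and>
        affine_asymptotic_direction \<alpha> q w \<and>
        (\<forall>w'. affine_asymptotic_direction \<alpha> q w' \<longrightarrow> w' \<in> span {w}) \<and>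
        w \<in> span {vector_derivative (\<alpha> \<circ> \<gamma>) (at 0)})"

end

theory Submission
  imports Defs
begin

text \<open>Differentiating \<open>\<langle>\<xi>, \<nu>\<^sub>u\<rangle> = \<langle>\<xi>, \<nu>\<^sub>v\<rangle> = 0\<close> turns the coefficients of the affine third
  fundamental form into \<open>- \<langle>\<xi>, \<nu>\<^sub>u\<^sub>u\<rangle>\<close>, \<open>- \<langle>\<xi>, \<nu>\<^sub>u\<^sub>v\<rangle>\<close>, \<open>- \<langle>\<xi>, \<nu>\<^sub>v\<^sub>v\<rangle>\<close>. Because \<open>\<xi>\<close> is the multiple
  \<open>\<nu>\<^sub>u \<and> \<nu>\<^sub>v / det(\<nu>, \<nu>\<^sub>u, \<nu>\<^sub>v)\<close> of the Euclidean normal of the co-normal surface, these are the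
  coefficients \<open>L\<close>, \<open>M\<close>, \<open>N\<close> of \<open>\<nu>\<close> divided by \<open>- det(\<nu>, \<nu>\<^sub>u, \<nu>\<^sub>v)\<close>. The two forms are thus
  proportional, so they have the same parabolic set and the same zero directions in the parameter
  plane, where tangency can be tested for both surfaces.\<close>

section \<open>Calculus of smooth maps\<close>

lemma Ck_on_cong:
  assumes "open U" and "\<And>x. x \<in> U \<Longrightarrow> f x = g x" and "Ck_on k f U"
  shows "Ck_on k g U"
  using assms(2,3)
proof (induction k arbitrary: f g)
  case 0
  then show ?case
    by (simp cong: continuous_on_cong)
next
  case (Suc k)
  have eq: "frechet_derivative f (at x) = frechet_derivative g (at x)" if "x \<in> U" for x
    using frechet_derivative_transform_within_open[of f x U g] Suc.prems that \<open>open U\<close> by simp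
  have "g differentiable at x" if "x \<in> U" for x
  proof -
    have "(f has_derivative frechet_derivative f (at x)) (at x)"
      using Suc.prems(2) that by (simp add: frechet_derivative_works[symmetric])
    then have "(g has_derivative frechet_derivative f (at x)) (at x)"
      using has_derivative_transform_within_open \<open>open U\<close> that Suc.prems(1) by blast
    then show ?thesis
      using differentiable_def by blast
  qed
  moreover have "Ck_on k (\<lambda>x. frechet_derivative g (at x) v) U" for v
    using Suc.IH[of "\<lambda>x. frechet_derivative f (at x) v"] Suc.prems(2) eq by simp
  ultimately show ?case
    by simp
qed

text \<open>\<open>Ck_on (Suc k)\<close> asks for differentiability but not literally for continuity
  of the lower derivatives. At the bottom level differentiability yields continuity, and the
  recursion passes this upwards.\<close>

lemma Ck_on_SucD: "Ck_on (Suc k) f U \<Longrightarrow> Ck_on k f U"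
proof (induction k arbitrary: f)
  case 0
  then show ?case
    by (auto intro!: continuous_at_imp_continuous_on differentiable_imp_continuous_within)
next
  case (Suc k)
  then show ?case
    by (metis Ck_on.simps(2))
qed

text \<open>Lets the closure properties below work with the explicit formulas of the differentiation
  rules: derivatives are unique, and on an open set agreement with \<open>frechet_derivative\<close>
  suffices.\<close>

lemma Ck_on_SucI:
  assumes "open U"
    and "\<And>x. x \<in> U \<Longrightarrow> (f has_derivative f' x) (at x)"
    and "\<And>v. Ck_on k (\<lambda>x. f' x v) U"
  shows "Ck_on (Suc k) f U"
proof -
  have "frechet_derivative f (at x) = f' x" if "x \<in> U" for x
    using assms(2)[OF that] frechet_derivative_at by metis
  moreover have "f differentiable at x" if "x \<in> U" for x
    using assms(2)[OF that] differentiable_def by blast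
  ultimately show ?thesis
    using assms(1,3) by (auto intro: Ck_on_cong[where f = "\<lambda>x. f' x v" for v])
qed

lemma Ck_on_has_derivative:
  "Ck_on (Suc k) f U \<Longrightarrow> x \<in> U \<Longrightarrow> (f has_derivative frechet_derivative f (at x)) (at x)"
  by (simp add: frechet_derivative_works[symmetric])

lemma Ck_on_add:
  assumes "open U" "Ck_on k f U" "Ck_on k g U"
  shows "Ck_on k (\<lambda>x. f x + g x) U"
  using assms(2,3)
proof (induction k arbitrary: f g)
  case 0
  then show ?case by (simp add: continuous_on_add)
next
  case (Suc k)
  show ?case
  proof (rule Ck_on_SucI[OF \<open>open U\<close>])
    show "((\<lambda>x. f x + g x) has_derivative
        (\<lambda>v. frechet_derivative f (at x) v + frechet_derivative g (at x) v)) (at x)"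
      if "x \<in> U" for x
      using Ck_on_has_derivative[OF Suc.prems(1) that] Ck_on_has_derivative[OF Suc.prems(2) that]
      by (rule has_derivative_add)
    show "Ck_on k (\<lambda>x. frechet_derivative f (at x) v + frechet_derivative g (at x) v) U" for v
      using Suc by simp
  qed
qed

lemma Ck_on_linear:
  assumes "bounded_linear h" "open U" "Ck_on k f U"
  shows "Ck_on k (\<lambda>x. h (f x)) U"
  using assms(3)
proof (induction k arbitrary: f)
  case 0
  then show ?case using assms(1) by (simp add: bounded_linear.continuous_on)
next
  case (Suc k)
  show ?case
  proof (rule Ck_on_SucI[OF \<open>open U\<close>])
    show "((\<lambda>x. h (f x)) has_derivative (\<lambda>v. h (frechet_derivative f (at x) v))) (at x)"
      if "x \<in> U" for x
      using Ck_on_has_derivative[OF Suc.prems that] assms(1)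
      by (rule bounded_linear.has_derivative[rotated])
    show "Ck_on k (\<lambda>x. h (frechet_derivative f (at x) v)) U" for v
      using Suc by simp
  qed
qed

text \<open>The Leibniz rule gives a sum of two terms of the same bilinear shape, each with one
  derivative fewer available, so the induction closes. Products, scalings, inner products and cross
  products are all instances.\<close>

lemma Ck_on_bilinear:
  assumes h: "bounded_bilinear h" and "open U" "Ck_on k f U" "Ck_on k g U"
  shows "Ck_on k (\<lambda>x. h (f x) (g x)) U"
  using assms(3,4)
proof (induction k arbitrary: f g)
  case 0
  then show ?case using h by (simp add: bounded_bilinear.continuous_on)
next
  case (Suc k)
  show ?case
  proof (rule Ck_on_SucI[OF \<open>open U\<close>])
    show "((\<lambda>x. h (f x) (g x)) has_derivative
        (\<lambda>v. h (f x) (frechet_derivative g (at x) v) + h (frechet_derivative f (at x) v) (g x))) (at x)"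
      if "x \<in> U" for x
      using bounded_bilinear.FDERIV[OF h Ck_on_has_derivative[OF Suc.prems(1) that]
          Ck_on_has_derivative[OF Suc.prems(2) that]] .
    show "Ck_on k (\<lambda>x. h (f x) (frechet_derivative g (at x) v)
        + h (frechet_derivative f (at x) v) (g x)) U" for v
      using Suc Ck_on_SucD[of k f U] Ck_on_SucD[of k g U]
      by (intro Ck_on_add \<open>open U\<close> Suc.IH) auto
  qed
qed

text \<open>Differentiation lowers the exponent by one, so the induction ranges over all exponents.
  Positivity of \<open>f\<close> keeps away from the singularity at zero.\<close>

lemma Ck_on_powr:
  fixes f :: "'a::euclidean_space \<Rightarrow> real"
  assumes "open U" "Ck_on k f U" "\<And>x. x \<in> U \<Longrightarrow> f x > 0"
  shows "Ck_on k (\<lambda>x. f x powr c) U"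
  using assms(2)
proof (induction k arbitrary: c)
  case 0
  have "f x \<noteq> 0" if "x \<in> U" for x
    using assms(3)[OF that] by simp
  with 0 show ?case
    by (simp add: continuous_on_powr)
next
  case (Suc k)
  show ?case
  proof (rule Ck_on_SucI[OF \<open>open U\<close>])
    \<comment> \<open>The derivative is arranged as a scalar multiple of a product, the shape to
      which \<open>Ck_on_linear\<close> and \<open>Ck_on_bilinear\<close> apply.\<close>
    show "((\<lambda>x. f x powr c) has_derivative
        (\<lambda>v. c *\<^sub>R (f x powr (c - 1) * frechet_derivative f (at x) v))) (at x)"
      if "x \<in> U" for x
    proof -
      note [derivative_intros] = Ck_on_has_derivative[OF Suc.prems that]
      show ?thesis
        using assms(3)[OF that]
        by (auto intro!: derivative_eq_intros simp: powr_diff field_simps)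
    qed
    show "Ck_on k (\<lambda>x. c *\<^sub>R (f x powr (c - 1) * frechet_derivative f (at x) v)) U" for v
      using Suc Ck_on_SucD[of k f U]
      by (intro Ck_on_linear[OF bounded_linear_scaleR_right] Ck_on_bilinear[OF bounded_bilinear_mult]
          \<open>open U\<close>) auto
  qed
qed

section \<open>Closure properties of smooth maps\<close>

lemma smooth_on_linear:
  "bounded_linear h \<Longrightarrow> open U \<Longrightarrow> smooth_on f U \<Longrightarrow> smooth_on (\<lambda>x. h (f x)) U"
  by (simp add: smooth_on_def Ck_on_linear)

lemma smooth_on_bilinear:
  "bounded_bilinear h \<Longrightarrow> open U \<Longrightarrow> smooth_on f U \<Longrightarrow> smooth_on g U
    \<Longrightarrow> smooth_on (\<lambda>x. h (f x) (g x)) U"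
  by (simp add: smooth_on_def Ck_on_bilinear)

lemma smooth_on_diff:
  assumes "open U" "smooth_on f U" "smooth_on g U"
  shows "smooth_on (\<lambda>x. f x - g x) U"
proof -
  have "smooth_on (\<lambda>x. - g x) U"
    using smooth_on_linear[OF bounded_linear_minus[OF bounded_linear_ident]] assms by blast
  then show ?thesis
    using Ck_on_add[of U _ f "\<lambda>x. - g x"] assms by (simp add: smooth_on_def)
qed

lemma smooth_on_powr:
  fixes f :: "'a::euclidean_space \<Rightarrow> real"
  shows "open U \<Longrightarrow> smooth_on f U \<Longrightarrow> (\<And>x. x \<in> U \<Longrightarrow> f x > 0) \<Longrightarrow> smooth_on (\<lambda>x. f x powr c) U"
  by (simp add: smooth_on_def Ck_on_powr)

lemma smooth_on_frechet_derivative: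
  "smooth_on f U \<Longrightarrow> smooth_on (\<lambda>x. frechet_derivative f (at x) v) U"
  by (metis smooth_on_def Ck_on.simps(2))

lemma smooth_on_du: "smooth_on f U \<Longrightarrow> smooth_on (du f) U"
  and smooth_on_dv: "smooth_on f U \<Longrightarrow> smooth_on (dv f) U"
  using smooth_on_frechet_derivative by (simp_all add: du_def[abs_def] dv_def[abs_def])

lemma smooth_on_differentiable: "smooth_on f U \<Longrightarrow> x \<in> U \<Longrightarrow> f differentiable at x"
  by (metis smooth_on_def Ck_on.simps(2))

lemma smooth_on_continuous: "smooth_on f U \<Longrightarrow> continuous_on U f"
  by (metis smooth_on_def Ck_on.simps(1))

section \<open>Symmetry of second derivatives\<close>

lemma has_real_derivative_along_line:
  fixes f :: "'a::real_normed_vector \<Rightarrow> real"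
  assumes "f differentiable at (a + s *\<^sub>R v)"
  shows "((\<lambda>s. f (a + s *\<^sub>R v)) has_real_derivative
    frechet_derivative f (at (a + s *\<^sub>R v)) v) (at s)"
proof -
  let ?D = "frechet_derivative f (at (a + s *\<^sub>R v))"
  have D: "(f has_derivative ?D) (at (a + s *\<^sub>R v))"
    using assms by (simp add: frechet_derivative_works[symmetric])
  have "((\<lambda>s. a + s *\<^sub>R v) has_derivative (\<lambda>h. h *\<^sub>R v)) (at s)"
    by (auto intro!: derivative_eq_intros)
  from has_derivative_compose[OF this D]
  have "((\<lambda>s. f (a + s *\<^sub>R v)) has_derivative (\<lambda>h. ?D (h *\<^sub>R v))) (at s)" .
  moreover have "?D (h *\<^sub>R v) = ?D v * h" for h
    using linear_cmul[OF has_derivative_linear[OF D]] by simp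
  ultimately show ?thesis
    by (simp add: has_field_derivative_def)
qed

text \<open>Two applications of the mean value theorem: first along \<open>v\<close> to a difference
  of values of \<open>f\<close>, then along \<open>w\<close> to the resulting difference of
  derivatives.\<close>

lemma second_difference_mvt:
  fixes f :: "'a::real_normed_vector \<Rightarrow> real"
  assumes "h > 0"
    and f: "\<And>s t. s \<in> {0..h} \<Longrightarrow> t \<in> {0..h} \<Longrightarrow> f differentiable at (x + s *\<^sub>R v + t *\<^sub>R w)"
    and Df: "\<And>s t. s \<in> {0..h} \<Longrightarrow> t \<in> {0..h} \<Longrightarrow>
      (\<lambda>y. frechet_derivative f (at y) v) differentiable at (x + s *\<^sub>R v + t *\<^sub>R w)"
  obtains s t where "s \<in> {0<..<h}" "t \<in> {0<..<h}"
    "f (x + h *\<^sub>R v + h *\<^sub>R w) - f (x + h *\<^sub>R v) - f (x + h *\<^sub>R w) + f x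
      = h * (h * frechet_derivative (\<lambda>y. frechet_derivative f (at y) v)
          (at (x + s *\<^sub>R v + t *\<^sub>R w)) w)"
proof -
  define Dv where "Dv = (\<lambda>y. frechet_derivative f (at y) v)"
  \<comment> \<open>Chosen so that the second difference of \<open>f\<close> over the parallelogram
    is the single increment \<open>g h - g 0\<close>.\<close>
  define g where "g = (\<lambda>s. f ((x + h *\<^sub>R w) + s *\<^sub>R v) - f (x + s *\<^sub>R v))"
  have "(g has_real_derivative Dv ((x + h *\<^sub>R w) + s *\<^sub>R v) - Dv (x + s *\<^sub>R v)) (at s)"
    if "0 \<le> s" "s \<le> h" for s
    unfolding g_def Dv_def using f[of s h] f[of s 0] that \<open>h > 0\<close>
    by (intro DERIV_diff has_real_derivative_along_line) (auto simp: add_ac)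
  from MVT2[OF \<open>h > 0\<close> this]
  obtain s where s: "0 < s" "s < h"
    "g h - g 0 = h * (Dv ((x + h *\<^sub>R w) + s *\<^sub>R v) - Dv (x + s *\<^sub>R v))"
    by auto
  have "((\<lambda>t. Dv ((x + s *\<^sub>R v) + t *\<^sub>R w)) has_real_derivative
      frechet_derivative Dv (at ((x + s *\<^sub>R v) + t *\<^sub>R w)) w) (at t)"
    if "0 \<le> t" "t \<le> h" for t
    unfolding Dv_def using Df[of s t] s that
    by (intro has_real_derivative_along_line) auto
  from MVT2[OF \<open>h > 0\<close> this]
  obtain t where t: "0 < t" "t < h"
    "Dv ((x + s *\<^sub>R v) + h *\<^sub>R w) - Dv (x + s *\<^sub>R v)
      = h * frechet_derivative Dv (at ((x + s *\<^sub>R v) + t *\<^sub>R w)) w"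
    by auto
  have "f (x + h *\<^sub>R v + h *\<^sub>R w) - f (x + h *\<^sub>R v) - f (x + h *\<^sub>R w) + f x = g h - g 0"
    by (simp add: g_def add_ac)
  also have "\<dots> = h * (h * frechet_derivative Dv (at (x + s *\<^sub>R v + t *\<^sub>R w)) w)"
    using s(3) t(3) by (simp add: add_ac)
  finally show thesis
    using that[of s t] s t by (simp add: Dv_def)
qed

text \<open>Schwarz's theorem. The second difference is symmetric in \<open>v\<close> and
  \<open>w\<close>, and it equals \<open>h * h\<close> times either mixed derivative at some point
  of a small parallelogram. By continuity both mixed derivatives agree in the limit; the proof
  phrases this as a contradiction.\<close>

lemma frechet_derivative_commute_real:
  fixes f :: "'a::euclidean_space \<Rightarrow> real"
  assumes "open U" "smooth_on f U" "x \<in> U"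
  shows "frechet_derivative (\<lambda>y. frechet_derivative f (at y) v) (at x) w
    = frechet_derivative (\<lambda>y. frechet_derivative f (at y) w) (at x) v"
proof (rule ccontr)
  define A where "A = (\<lambda>x v w. frechet_derivative (\<lambda>y. frechet_derivative f (at y) v) (at x) w)"
  assume "\<not> ?thesis"
  \<comment> \<open>Half the supposed gap: two values within this distance of one common number are
    closer together than the gap.\<close>
  then have "\<bar>A x v w - A x w v\<bar> / 2 > 0" (is "?e > 0")
    by (simp add: A_def)
  have cont: "isCont (\<lambda>y. A y v w) x" for v w
    using smooth_on_continuous smooth_on_frechet_derivative assms continuous_on_eq_continuous_at
    unfolding A_def by blast
  have ev: "\<forall>\<^sub>F y in nhds x. dist (A y v w) (A x v w) < ?e" for v w
    using cont[of v w] \<open>?e > 0\<close> unfolding continuous_at tendsto_at_iff_tendsto_nhds[of "\<lambda>y. A y v w" x]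
    by (rule tendstoD)
  have "\<forall>\<^sub>F y in nhds x. y \<in> U \<and> dist (A y v w) (A x v w) < ?e \<and> dist (A y w v) (A x w v) < ?e"
    by (intro eventually_conj ev eventually_nhds_in_open assms)
  then obtain d where "d > 0" and d: "\<And>y. dist y x < d \<Longrightarrow>
      y \<in> U \<and> dist (A y v w) (A x v w) < ?e \<and> dist (A y w v) (A x w v) < ?e"
    unfolding eventually_nhds_metric by auto
  \<comment> \<open>Small enough for both parallelograms to lie in the ball of radius
    \<open>d\<close>; the summand 1 keeps the denominator positive even if \<open>v\<close> and
    \<open>w\<close> vanish.\<close>
  define h where "h = d / (norm v + norm w + 1)"
  have "norm v + norm w + 1 > 0"
    by (simp add: add_nonneg_pos)
  then have "h > 0" and h: "h * (norm v + norm w) < d"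
    using \<open>d > 0\<close> by (simp_all add: h_def field_simps)
  have near: "dist (x + s *\<^sub>R v + t *\<^sub>R w) x < d" if "s \<in> {0..h}" "t \<in> {0..h}" for s t
  proof -
    have "dist (x + s *\<^sub>R v + t *\<^sub>R w) x \<le> norm (s *\<^sub>R v) + norm (t *\<^sub>R w)"
      by (simp add: dist_norm add.assoc) (metis norm_triangle_ineq norm_scaleR)
    also have "\<dots> \<le> h * norm v + h * norm w"
      using that by (auto intro!: add_mono mult_right_mono)
    finally show ?thesis
      using h by (simp add: distrib_left)
  qed
  have diff: "f differentiable at y" "(\<lambda>y. frechet_derivative f (at y) u) differentiable at y"
    if "dist y x < d" for y u
    using d[OF that] assms smooth_on_differentiable smooth_on_frechet_derivative by blast+
  obtain s t where st: "s \<in> {0<..<h}" "t \<in> {0<..<h}"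
    "f (x + h *\<^sub>R v + h *\<^sub>R w) - f (x + h *\<^sub>R v) - f (x + h *\<^sub>R w) + f x
      = h * (h * A (x + s *\<^sub>R v + t *\<^sub>R w) v w)"
    unfolding A_def using second_difference_mvt[OF \<open>h > 0\<close>, of f x v w] diff near by metis
  have near': "dist (x + s *\<^sub>R w + t *\<^sub>R v) x < d" if "s \<in> {0..h}" "t \<in> {0..h}" for s t
    using near[OF that(2,1)] by (simp add: add_ac)
  obtain s' t' where st': "s' \<in> {0<..<h}" "t' \<in> {0<..<h}"
    "f (x + h *\<^sub>R w + h *\<^sub>R v) - f (x + h *\<^sub>R w) - f (x + h *\<^sub>R v) + f x
      = h * (h * A (x + s' *\<^sub>R w + t' *\<^sub>R v) w v)"
    unfolding A_def using second_difference_mvt[OF \<open>h > 0\<close>, of f x w v] diff near' by metis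
  have "x + h *\<^sub>R w + h *\<^sub>R v = x + h *\<^sub>R v + h *\<^sub>R w"
    by (simp add: add_ac)
  then have "h * (h * A (x + s *\<^sub>R v + t *\<^sub>R w) v w) = h * (h * A (x + s' *\<^sub>R w + t' *\<^sub>R v) w v)"
    using st(3) st'(3) by (simp add: algebra_simps)
  then have "A (x + s *\<^sub>R v + t *\<^sub>R w) v w = A (x + s' *\<^sub>R w + t' *\<^sub>R v) w v"
    using \<open>h > 0\<close> by simp
  moreover have "dist (A (x + s *\<^sub>R v + t *\<^sub>R w) v w) (A x v w) < ?e"
    using d near st by simp
  moreover have "dist (A (x + s' *\<^sub>R w + t' *\<^sub>R v) w v) (A x w v) < ?e"
    using d near' st' by simp
  ultimately have "dist (A x v w) (A x w v) < \<bar>A x v w - A x w v\<bar>"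
    using dist_triangle_half_r by metis
  then show False
    by (simp add: dist_real_def)
qed

text \<open>Reduces to the real case by components, since the inner product with a fixed basis
  vector commutes with differentiation.\<close>

lemma frechet_derivative_commute:
  fixes f :: "'a::euclidean_space \<Rightarrow> 'b::euclidean_space"
  assumes "open U" "smooth_on f U" "x \<in> U"
  shows "frechet_derivative (\<lambda>y. frechet_derivative f (at y) v) (at x) w
    = frechet_derivative (\<lambda>y. frechet_derivative f (at y) w) (at x) v"
proof (rule euclidean_eqI)
  fix b :: 'b
  have comp: "frechet_derivative (\<lambda>y. g y \<bullet> b) (at y) = (\<lambda>v. frechet_derivative g (at y) v \<bullet> b)"
    if "smooth_on g U" "y \<in> U" for g :: "'a \<Rightarrow> 'b" and y
  proof -
    have "(g has_derivative frechet_derivative g (at y)) (at y)"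
      using smooth_on_differentiable[OF that] by (simp add: frechet_derivative_works[symmetric])
    from has_derivative_inner_left[OF this, of b] show ?thesis
      by (rule frechet_derivative_at[symmetric])
  qed
  have smooth: "smooth_on (\<lambda>y. f y \<bullet> b) U"
    by (rule smooth_on_linear[OF bounded_linear_inner_left assms(1,2)])
  have second: "frechet_derivative (\<lambda>y. frechet_derivative (\<lambda>y. f y \<bullet> b) (at y) v) (at x) w
      = frechet_derivative (\<lambda>y. frechet_derivative f (at y) v) (at x) w \<bullet> b" for v w
  proof -
    \<comment> \<open>The component formula \<open>comp\<close> holds only on \<open>U\<close>;
      openness of \<open>U\<close> permits differentiating it once more.\<close>
    have "frechet_derivative (\<lambda>y. frechet_derivative (\<lambda>y. f y \<bullet> b) (at y) v) (at x)
        = frechet_derivative (\<lambda>y. frechet_derivative f (at y) v \<bullet> b) (at x)"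
      using comp[OF assms(2)] assms
      by (intro frechet_derivative_transform_within_open[of _ _ U]
          smooth_on_differentiable[OF smooth_on_frechet_derivative[OF smooth]]) auto
    then show ?thesis
      using comp[OF smooth_on_frechet_derivative[OF assms(2)] assms(3)] by simp
  qed
  show "frechet_derivative (\<lambda>y. frechet_derivative f (at y) v) (at x) w \<bullet> b
    = frechet_derivative (\<lambda>y. frechet_derivative f (at y) w) (at x) v \<bullet> b"
    using frechet_derivative_commute_real[OF assms(1) smooth assms(3)] second by simp
qed

lemma du_dv_commute:
  "open U \<Longrightarrow> smooth_on f U \<Longrightarrow> x \<in> U \<Longrightarrow> du (dv f) x = dv (du f) x"
  unfolding du_def[abs_def] dv_def[abs_def] by (rule frechet_derivative_commute)

section \<open>Derivatives in coordinates and of constant inner products\<close>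

lemma frechet_derivative_pair:
  assumes "f differentiable at q"
  shows "frechet_derivative f (at q) (a, b) = a *\<^sub>R du f q + b *\<^sub>R dv f q"
proof -
  note lin = linear_frechet_derivative[OF assms]
  have "(a, b) = a *\<^sub>R (1, 0) + b *\<^sub>R (0, 1)"
    by simp
  then have "frechet_derivative f (at q) (a, b)
      = frechet_derivative f (at q) (a *\<^sub>R (1, 0) + b *\<^sub>R (0, 1))"
    by (rule arg_cong)
  then show ?thesis
    by (simp only: linear_add[OF lin] linear_cmul[OF lin] du_def dv_def)
qed

text \<open>The product rule for a constant function; it moves a derivative from one factor to the
  other at the price of a sign.\<close>

lemma inner_const_derivative:
  fixes f g :: "'a::euclidean_space \<Rightarrow> 'b::euclidean_space"
  assumes "open U" "q \<in> U" "\<And>x. x \<in> U \<Longrightarrow> f x \<bullet> g x = c"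
    and "f differentiable at q" "g differentiable at q"
  shows "frechet_derivative f (at q) v \<bullet> g q = - (f q \<bullet> frechet_derivative g (at q) v)"
proof -
  have "((\<lambda>x. f x \<bullet> g x) has_derivative
      (\<lambda>v. f q \<bullet> frechet_derivative g (at q) v + frechet_derivative f (at q) v \<bullet> g q)) (at q)"
    using assms(4,5) by (intro has_derivative_inner) (simp_all add: frechet_derivative_works[symmetric])
  moreover have "((\<lambda>x. f x \<bullet> g x) has_derivative (\<lambda>v. 0)) (at q)"
    using has_derivative_transform_within_open[OF has_derivative_const[of c] assms(1,2)] assms(3)
    by simp
  ultimately have "(\<lambda>v. f q \<bullet> frechet_derivative g (at q) v + frechet_derivative f (at q) v \<bullet> g q)
      = (\<lambda>v. 0)"
    by (rule has_derivative_unique)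
  from fun_cong[OF this, of v] show ?thesis
    by simp
qed

section \<open>The co-normal surface\<close>

lemma det3_eq_inner_cross3: "det3 a b c = cross3 a b \<bullet> c"
  by (simp add: det3_def dot_cross_det[symmetric]) (simp add: cross3_def inner_vec_def sum_3 algebra_simps)

text \<open>Lagrange's identity in its four-vector (Binet-Cauchy) form.\<close>

lemma inner_cross3_cross3:
  fixes a b c d :: "real^3"
  shows "cross3 a b \<bullet> cross3 c d = (a \<bullet> c) * (b \<bullet> d) - (a \<bullet> d) * (b \<bullet> c)"
  by (simp add: cross3_def inner_vec_def sum_3 algebra_simps)

text \<open>A nonzero triple product makes \<open>a\<close>, \<open>b\<close>, \<open>c\<close> a
  basis, and the three conditions single out the dual basis vector belonging to \<open>a\<close>.
  This makes the description of the affine normal well defined and explicit.\<close>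

lemma the_dual_vector:
  fixes a b c :: "real^3"
  assumes "a \<bullet> cross3 b c \<noteq> 0"
  shows "(THE x. a \<bullet> x = 1 \<and> x \<bullet> b = 0 \<and> x \<bullet> c = 0) = (1 / (a \<bullet> cross3 b c)) *\<^sub>R cross3 b c"
proof (rule the_equality)
  show "a \<bullet> ((1 / (a \<bullet> cross3 b c)) *\<^sub>R cross3 b c) = 1 \<and>
      ((1 / (a \<bullet> cross3 b c)) *\<^sub>R cross3 b c) \<bullet> b = 0 \<and>
      ((1 / (a \<bullet> cross3 b c)) *\<^sub>R cross3 b c) \<bullet> c = 0"
    using assms by (simp add: dot_cross_self)
next
  fix x assume x: "a \<bullet> x = 1 \<and> x \<bullet> b = 0 \<and> x \<bullet> c = 0"
  \<comment> \<open>Cramer's rule: the expansion of an arbitrary \<open>x\<close> in the dual basis,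
    cleared of its denominator.\<close>
  have "(a \<bullet> cross3 b c) *\<^sub>R x
      = (a \<bullet> x) *\<^sub>R cross3 b c + (x \<bullet> b) *\<^sub>R cross3 c a + (x \<bullet> c) *\<^sub>R cross3 a b"
    by (simp add: cross3_def inner_vec_def sum_3 vec_eq_iff forall_3; algebra)
  then have "(a \<bullet> cross3 b c) *\<^sub>R x = cross3 b c"
    using x by simp
  then have "(1 / (a \<bullet> cross3 b c)) *\<^sub>R (a \<bullet> cross3 b c) *\<^sub>R x
      = (1 / (a \<bullet> cross3 b c)) *\<^sub>R cross3 b c"
    by simp
  then show "x = (1 / (a \<bullet> cross3 b c)) *\<^sub>R cross3 b c"
    using assms by simp
qed

lemma bounded_bilinear_cross3: "bounded_bilinear cross3"
  using bilinear_cross by (simp add: bilinear_conv_bounded_bilinear)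

section \<open>The co-normal map and the affine normal\<close>

locale nonparabolic_chart =
  fixes \<alpha> :: "real \<times> real \<Rightarrow> real^3" and U :: "(real \<times> real) set"
  assumes open_U: "open U"
    and smooth: "smooth_on \<alpha> U"
    and nonparabolic: "x \<in> U \<Longrightarrow> LN_M2 \<alpha> x \<noteq> 0"
begin

abbreviation "\<nu> \<equiv> conormal \<alpha>"
abbreviation "\<xi> \<equiv> affine_normal \<alpha>"

text \<open>The determinant of \<nu> and its two partial derivatives. Its nonvanishing gives both
  the immersivity of \<nu> and the existence of \<xi>.\<close>

definition volume :: "real \<times> real \<Rightarrow> real" where
  "volume q = \<nu> q \<bullet> cross3 (du \<nu> q) (dv \<nu> q)"

lemma smooth_LN_M2: "smooth_on (LN_M2 \<alpha>) U"
proof -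
  have "smooth_on (\<lambda>q. (cross3 (du \<alpha> q) (dv \<alpha> q) \<bullet> du (du \<alpha>) q)
      * (cross3 (du \<alpha> q) (dv \<alpha> q) \<bullet> dv (dv \<alpha>) q)
      - (cross3 (du \<alpha> q) (dv \<alpha> q) \<bullet> dv (du \<alpha>) q) * (cross3 (du \<alpha> q) (dv \<alpha> q) \<bullet> dv (du \<alpha>) q)) U"
    by (intro smooth_on_diff smooth_on_bilinear[OF bounded_bilinear_mult]
        smooth_on_bilinear[OF bounded_bilinear_inner] smooth_on_bilinear[OF bounded_bilinear_cross3]
        smooth_on_du smooth_on_dv smooth open_U)
  then show ?thesis
    by (simp add: LN_M2_def[abs_def] coeff_L_def coeff_M_def coeff_N_def det3_eq_inner_cross3
        power2_eq_square)
qed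

lemma smooth_conormal: "smooth_on \<nu> U"
proof -
  \<comment> \<open>Passing from \<open>|K|\<close> to \<open>K\<^sup>2\<close> avoids the non-smooth absolute value.\<close>
  have "\<bar>K\<bar> powr (- 1 / 4) = (K * K) powr (- 1 / 8)" for K :: real
  proof -
    have K: "K * K = \<bar>K\<bar> powr 2"
      by (simp add: power2_eq_square)
    show ?thesis
      unfolding K powr_powr by simp
  qed
  then have "\<nu> = (\<lambda>q. ((LN_M2 \<alpha> q * LN_M2 \<alpha> q) powr (- 1 / 8)) *\<^sub>R cross3 (du \<alpha> q) (dv \<alpha> q))"
    by (auto simp: conormal_def)
  moreover have "smooth_on \<dots> U"
    using nonparabolic
    by (intro smooth_on_powr smooth_on_bilinear[OF bounded_bilinear_scaleR]
        smooth_on_bilinear[OF bounded_bilinear_mult] smooth_on_bilinear[OF bounded_bilinear_cross3]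
        smooth_on_du smooth_on_dv smooth smooth_LN_M2 open_U)
      (auto simp: zero_less_mult_iff linorder_neq_iff)
  ultimately show ?thesis
    by simp
qed

lemmas differentiable_chart =
  smooth_on_differentiable[OF smooth]
  smooth_on_differentiable[OF smooth_on_du[OF smooth]]
  smooth_on_differentiable[OF smooth_on_dv[OF smooth]]

lemmas differentiable_conormal =
  smooth_on_differentiable[OF smooth_conormal]
  smooth_on_differentiable[OF smooth_on_du[OF smooth_conormal]]
  smooth_on_differentiable[OF smooth_on_dv[OF smooth_conormal]]

lemma conormal_orthogonal: "\<nu> q \<bullet> du \<alpha> q = 0" "\<nu> q \<bullet> dv \<alpha> q = 0"
  by (simp_all add: conormal_def dot_cross_self)

text \<open>Since \<open>\<nu> \<bullet> \<alpha>\<^sub>u = \<nu> \<bullet> \<alpha>\<^sub>v = 0\<close>, the products of the first derivatives of \<open>\<nu>\<close> and \<open>\<alpha>\<close> are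
  multiples of \<open>L\<close>, \<open>M\<close>, \<open>N\<close>, and Lagrange's identity turns the volume into a multiple of
  \<open>L N - M\<^sup>2\<close>.\<close>

lemma volume_nonzero:
  assumes "q \<in> U"
  shows "volume q \<noteq> 0"
proof -
  define c where "c = \<bar>LN_M2 \<alpha> q\<bar> powr (- 1 / 4)"
  have "c \<noteq> 0"
    using nonparabolic[OF assms] by (simp add: c_def)
  have \<nu>: "\<nu> q = c *\<^sub>R cross3 (du \<alpha> q) (dv \<alpha> q)"
    by (simp add: conormal_def c_def)
  have u: "frechet_derivative \<nu> (at q) h \<bullet> du \<alpha> q = - (\<nu> q \<bullet> frechet_derivative (du \<alpha>) (at q) h)" for h
    by (rule inner_const_derivative[OF open_U assms conormal_orthogonal(1)])
      (simp_all add: assms differentiable_chart differentiable_conormal)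
  have v: "frechet_derivative \<nu> (at q) h \<bullet> dv \<alpha> q = - (\<nu> q \<bullet> frechet_derivative (dv \<alpha>) (at q) h)" for h
    by (rule inner_const_derivative[OF open_U assms conormal_orthogonal(2)])
      (simp_all add: assms differentiable_chart differentiable_conormal)
  have "du \<nu> q \<bullet> du \<alpha> q = - c * coeff_L \<alpha> q"
    using u[of "(1, 0)"] by (simp add: \<nu> du_def[symmetric] coeff_L_def det3_eq_inner_cross3)
  moreover have "dv \<nu> q \<bullet> du \<alpha> q = - c * coeff_M \<alpha> q"
    using u[of "(0, 1)"] by (simp add: \<nu> dv_def[symmetric] coeff_M_def det3_eq_inner_cross3)
  \<comment> \<open>Here the second derivative arises as \<open>du (dv \<alpha>)\<close>, whereas
    \<open>coeff_M\<close> uses \<open>dv (du \<alpha>)\<close>; symmetry reconciles them.\<close>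
  moreover have "du \<nu> q \<bullet> dv \<alpha> q = - c * coeff_M \<alpha> q"
    using v[of "(1, 0)"] du_dv_commute[OF open_U smooth assms]
    by (simp add: \<nu> du_def[symmetric] coeff_M_def det3_eq_inner_cross3)
  moreover have "dv \<nu> q \<bullet> dv \<alpha> q = - c * coeff_N \<alpha> q"
    using v[of "(0, 1)"] by (simp add: \<nu> dv_def[symmetric] coeff_N_def det3_eq_inner_cross3)
  ultimately have "cross3 (du \<nu> q) (dv \<nu> q) \<bullet> cross3 (du \<alpha> q) (dv \<alpha> q) = c\<^sup>2 * LN_M2 \<alpha> q"
    by (simp add: inner_cross3_cross3 LN_M2_def power2_eq_square algebra_simps)
  \<comment> \<open>The third factor \<open>c\<close> comes from \<nu> itself.\<close>
  then have "volume q = c ^ 3 * LN_M2 \<alpha> q"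
    by (simp add: volume_def \<nu> inner_commute power2_eq_square power3_eq_cube)
  then show ?thesis
    using \<open>c \<noteq> 0\<close> nonparabolic[OF assms] by simp
qed

lemma affine_normal_eq:
  "q \<in> U \<Longrightarrow> \<xi> q = (1 / volume q) *\<^sub>R cross3 (du \<nu> q) (dv \<nu> q)"
  using the_dual_vector volume_nonzero unfolding affine_normal_def volume_def by blast

text \<open>The explicit formula is a quotient of smooth maps with nonvanishing denominator, and it
  is valid on an open set, so differentiability transfers to \<xi>.\<close>

lemma differentiable_affine_normal:
  assumes "q \<in> U"
  shows "\<xi> differentiable at q"
proof -
  have cross: "smooth_on (\<lambda>q. cross3 (du \<nu> q) (dv \<nu> q)) U"
    by (intro smooth_on_bilinear[OF bounded_bilinear_cross3] smooth_on_du smooth_on_dv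
        smooth_conormal open_U)
  have "smooth_on volume U"
    unfolding volume_def[abs_def]
    by (intro smooth_on_bilinear[OF bounded_bilinear_inner] cross smooth_conormal open_U)
  then have "(\<lambda>q. (1 / volume q) *\<^sub>R cross3 (du \<nu> q) (dv \<nu> q)) differentiable at q"
    using assms volume_nonzero
    by (intro differentiable_scaleR differentiable_divide differentiable_const
        smooth_on_differentiable[OF cross] smooth_on_differentiable) auto
  then show ?thesis
    using affine_normal_eq assms open_U has_derivative_transform_within_open
    unfolding differentiable_def by (metis (no_types, lifting))
qed

section \<open>Comparison of the two quadratic forms\<close>

text \<open>Differentiates the orthogonality of \<xi> and \<open>du \<nu>\<close>. Keeping the
  direction \<open>h\<close> arbitrary covers both partial derivatives of \<xi> at once.\<close>

lemma conormal_u_inner_affine_normal_derivative: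
  assumes "q \<in> U"
  shows "du \<nu> q \<bullet> frechet_derivative \<xi> (at q) h
    = - (cross3 (du \<nu> q) (dv \<nu> q) \<bullet> frechet_derivative (du \<nu>) (at q) h) / volume q"
proof -
  have "frechet_derivative \<xi> (at q) h \<bullet> du \<nu> q = - (\<xi> q \<bullet> frechet_derivative (du \<nu>) (at q) h)"
    by (rule inner_const_derivative[OF open_U assms, where c = 0])
      (simp_all add: affine_normal_eq dot_cross_self assms differentiable_conormal
        differentiable_affine_normal)
  then show ?thesis
    using assms by (simp add: affine_normal_eq inner_commute)
qed

lemma conormal_v_inner_affine_normal_derivative:
  assumes "q \<in> U"
  shows "dv \<nu> q \<bullet> frechet_derivative \<xi> (at q) h
    = - (cross3 (du \<nu> q) (dv \<nu> q) \<bullet> frechet_derivative (dv \<nu>) (at q) h) / volume q"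
proof -
  have "frechet_derivative \<xi> (at q) h \<bullet> dv \<nu> q = - (\<xi> q \<bullet> frechet_derivative (dv \<nu>) (at q) h)"
    by (rule inner_const_derivative[OF open_U assms, where c = 0])
      (simp_all add: affine_normal_eq dot_cross_self assms differentiable_conormal
        differentiable_affine_normal)
  then show ?thesis
    using assms by (simp add: affine_normal_eq inner_commute)
qed

lemma coeff_l_eq: "q \<in> U \<Longrightarrow> coeff_l \<alpha> q = - coeff_L \<nu> q / volume q"
  and coeff_m_eq: "q \<in> U \<Longrightarrow> coeff_m \<alpha> q = - coeff_M \<nu> q / volume q"
  and coeff_n_eq: "q \<in> U \<Longrightarrow> coeff_n \<alpha> q = - coeff_N \<nu> q / volume q"
  using conormal_u_inner_affine_normal_derivative[of q "(1, 0)"]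
    conormal_u_inner_affine_normal_derivative[of q "(0, 1)"]
    conormal_v_inner_affine_normal_derivative[of q "(0, 1)"]
  by (simp_all add: coeff_l_def coeff_m_def coeff_n_def coeff_L_def coeff_M_def coeff_N_def
      det3_eq_inner_cross3 du_def[symmetric] dv_def[symmetric])

lemma affine_parabolic_set_eq: "affine_parabolic_set \<alpha> U = parabolic_set \<nu> U"
proof -
  have "coeff_l \<alpha> q * coeff_n \<alpha> q - (coeff_m \<alpha> q)\<^sup>2 = 0 \<longleftrightarrow> LN_M2 \<nu> q = 0" if "q \<in> U" for q
  proof -
    \<comment> \<open>All three coefficients share the factor \<open>- 1 / volume q\<close>; the
      discriminant is quadratic in them, so the sign cancels.\<close>
    have "coeff_l \<alpha> q * coeff_n \<alpha> q - (coeff_m \<alpha> q)\<^sup>2 = LN_M2 \<nu> q / (volume q)\<^sup>2"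
      using that
      by (simp add: coeff_l_eq coeff_m_eq coeff_n_eq LN_M2_def power2_eq_square divide_inverse
          algebra_simps)
    then show ?thesis
      using volume_nonzero[OF that] by (simp only: divide_eq_0_iff power_eq_0_iff) simp
  qed
  then show ?thesis
    by (auto simp only: affine_parabolic_set_def parabolic_set_def)
qed

lemma affine_third_form_eq:
  assumes "q \<in> U"
  shows "affine_third_form \<alpha> q a b
    = - (coeff_L \<nu> q * a\<^sup>2 + 2 * coeff_M \<nu> q * a * b + coeff_N \<nu> q * b\<^sup>2) / volume q"
proof -
  \<comment> \<open>Expanding the form also produces this second mixed product, which is not one of
    \<open>l\<close>, \<open>m\<close>, \<open>n\<close> by definition. Symmetry of the second
    derivatives of \<nu> gives it the value of \<open>m\<close>.\<close>
  have vu: "dv \<nu> q \<bullet> du \<xi> q = - coeff_M \<nu> q / volume q"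
    using conormal_v_inner_affine_normal_derivative[OF assms, of "(1, 0)"]
      du_dv_commute[OF open_U smooth_conormal assms]
    by (simp add: coeff_M_def det3_eq_inner_cross3 du_def[symmetric])
  have "affine_third_form \<alpha> q a b = coeff_l \<alpha> q * a\<^sup>2 + coeff_m \<alpha> q * a * b
      + (dv \<nu> q \<bullet> du \<xi> q) * a * b + coeff_n \<alpha> q * b\<^sup>2"
    using assms
    by (simp add: affine_third_form_def frechet_derivative_pair differentiable_conormal
        differentiable_affine_normal coeff_l_def coeff_m_def coeff_n_def inner_simps
        power2_eq_square algebra_simps)
  then show ?thesis
    using assms
    by (simp add: vu coeff_l_eq coeff_m_eq coeff_n_eq divide_inverse algebra_simps)
qed

text \<open>Up to sign both sides have the same quadratic polynomial in \<open>a\<close> and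
  \<open>b\<close> as numerator, over the nonzero denominators \<open>volume q\<close> and the norm
  of the cross product.\<close>

lemma affine_third_form_eq_0_iff:
  assumes "q \<in> U"
  shows "affine_third_form \<alpha> q a b = 0 \<longleftrightarrow> second_form \<nu> q a b = 0"
proof -
  have "cross3 (du \<nu> q) (dv \<nu> q) \<noteq> 0"
    using volume_nonzero[OF assms] by (auto simp: volume_def)
  then show ?thesis
    using volume_nonzero[OF assms] unfolding affine_third_form_eq[OF assms] second_form_def
    by (simp only: divide_eq_0_iff neg_equal_0_iff_equal norm_eq_zero)
qed

end

section \<open>Immersions and tangency in the parameter plane\<close>

text \<open>Taking the cross product of a linear relation between the partial derivatives with
  either of them isolates one coefficient, which must then vanish.\<close>

lemma inj_frechet_derivative_if_cross3:
  assumes "f differentiable at q" "cross3 (du f q) (dv f q) \<noteq> 0"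
  shows "inj (frechet_derivative f (at q))"
proof (subst linear_injective_0[OF linear_frechet_derivative[OF assms(1)]], intro allI impI)
  fix p assume p: "frechet_derivative f (at q) p = 0"
  obtain a b where [simp]: "p = (a, b)"
    by (cases p)
  have 0: "a *\<^sub>R du f q + b *\<^sub>R dv f q = 0"
    using p assms(1) by (simp add: frechet_derivative_pair)
  have "cross3 (a *\<^sub>R du f q + b *\<^sub>R dv f q) (dv f q) = a *\<^sub>R cross3 (du f q) (dv f q)"
    and "cross3 (du f q) (a *\<^sub>R du f q + b *\<^sub>R dv f q) = b *\<^sub>R cross3 (du f q) (dv f q)"
    by (simp_all add: cross_add_left cross_add_right cross_mult_left cross_mult_right)
  then show "p = 0"
    using assms(2) unfolding 0 by (simp add: zero_prod_def)
qed

lemma linear_inj_span_singleton_iff: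
  assumes "linear T" "inj T"
  shows "T x \<in> span {T y} \<longleftrightarrow> x \<in> span {y}"
  by (simp add: span_singleton image_iff linear_cmul[OF assms(1), symmetric] inj_eq[OF assms(2)])

lemma vector_derivative_compose_curve:
  assumes "regular_curve_near C q \<gamma>" "f differentiable at q"
  shows "vector_derivative (f \<circ> \<gamma>) (at 0) = frechet_derivative f (at q) (vector_derivative \<gamma> (at 0))"
proof -
  obtain \<epsilon> :: real where "\<epsilon> > 0" "smooth_on \<gamma> {-\<epsilon><..<\<epsilon>}" "\<gamma> 0 = q"
    using assms(1) unfolding regular_curve_near_def by blast
  then have "\<gamma> differentiable at 0"
    using smooth_on_differentiable by force
  then have \<gamma>: "(\<gamma> has_vector_derivative vector_derivative \<gamma> (at 0)) (at 0)"
    by (simp add: vector_derivative_works)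
  have "(f has_derivative frechet_derivative f (at q)) (at (\<gamma> 0))"
    using assms(2) \<open>\<gamma> 0 = q\<close> by (simp add: frechet_derivative_works[symmetric])
  from vector_derivative_diff_chain_within[OF \<gamma> has_derivative_at_withinI[OF this]]
  show ?thesis
    by (rule vector_derivative_at)
qed

text \<open>The right-hand side no longer mentions the immersion \<open>f\<close>, which is what allows passing from
  \<open>\<alpha>\<close> to \<open>\<nu>\<close>.\<close>

lemma tangent_zero_direction_iff:
  fixes f :: "real \<times> real \<Rightarrow> real^3" and Q :: "real \<Rightarrow> real \<Rightarrow> bool"
  assumes f: "f differentiable at q" and inj: "inj (frechet_derivative f (at q))"
  defines "dir \<equiv> \<lambda>w. w \<noteq> 0 \<and> (\<exists>a b. w = a *\<^sub>R du f q + b *\<^sub>R dv f q \<and> Q a b)"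
  shows "(\<exists>\<gamma> w. regular_curve_near C q \<gamma> \<and> dir w \<and> (\<forall>w'. dir w' \<longrightarrow> w' \<in> span {w}) \<and>
        w \<in> span {vector_derivative (f \<circ> \<gamma>) (at 0)})
    \<longleftrightarrow> (\<exists>\<gamma> p. regular_curve_near C q \<gamma> \<and> (p \<noteq> 0 \<and> case_prod Q p) \<and>
        (\<forall>p'. p' \<noteq> 0 \<and> case_prod Q p' \<longrightarrow> p' \<in> span {p}) \<and>
        p \<in> span {vector_derivative \<gamma> (at 0)})"
proof -
  let ?T = "frechet_derivative f (at q)"
  have lin: "linear ?T"
    by (rule linear_frechet_derivative[OF f])
  have T0: "?T p = 0 \<longleftrightarrow> p = 0" for p
    using lin inj by (metis linear_0 injD)
  \<comment> \<open>Injectivity makes nonzero tangent vectors correspond to nonzero parameter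
    vectors, so that existence, uniqueness and tangency can all be pulled back through
    \<open>?T\<close>.\<close>
  have dir: "dir w \<longleftrightarrow> (\<exists>p. w = ?T p \<and> p \<noteq> 0 \<and> case_prod Q p)" for w
    unfolding dir_def using frechet_derivative_pair[OF f] T0
    by (metis (no_types, lifting) case_prod_conv surj_pair)
  have uniq: "(\<forall>w'. dir w' \<longrightarrow> w' \<in> span {?T p})
      \<longleftrightarrow> (\<forall>p'. p' \<noteq> 0 \<and> case_prod Q p' \<longrightarrow> p' \<in> span {p})" for p
    unfolding dir using linear_inj_span_singleton_iff[OF lin inj] by blast
  have tangent: "?T p \<in> span {vector_derivative (f \<circ> \<gamma>) (at 0)}
      \<longleftrightarrow> p \<in> span {vector_derivative \<gamma> (at 0)}" if "regular_curve_near C q \<gamma>" for p \<gamma>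
    using vector_derivative_compose_curve[OF that f] linear_inj_span_singleton_iff[OF lin inj] by simp
  show ?thesis
  proof (intro iffI; elim exE conjE)
    fix \<gamma> w
    assume \<gamma>: "regular_curve_near C q \<gamma>" and w: "dir w" "\<forall>w'. dir w' \<longrightarrow> w' \<in> span {w}"
      "w \<in> span {vector_derivative (f \<circ> \<gamma>) (at 0)}"
    obtain p where p: "w = ?T p" "p \<noteq> 0 \<and> case_prod Q p"
      using w(1) unfolding dir by blast
    have "\<forall>p'. p' \<noteq> 0 \<and> case_prod Q p' \<longrightarrow> p' \<in> span {p}"
      using w(2) unfolding p(1) uniq .
    moreover have "p \<in> span {vector_derivative \<gamma> (at 0)}"
      using w(3) unfolding p(1) tangent[OF \<gamma>] .
    ultimately show "\<exists>\<gamma> p. regular_curve_near C q \<gamma> \<and> (p \<noteq> 0 \<and> case_prod Q p) \<and>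
        (\<forall>p'. p' \<noteq> 0 \<and> case_prod Q p' \<longrightarrow> p' \<in> span {p}) \<and>
        p \<in> span {vector_derivative \<gamma> (at 0)}"
      using \<gamma> p(2) by (intro exI[of _ \<gamma>] exI[of _ p] conjI) auto
  next
    fix \<gamma> p
    assume \<gamma>: "regular_curve_near C q \<gamma>" and p: "p \<noteq> 0" "case_prod Q p"
      "\<forall>p'. p' \<noteq> 0 \<and> case_prod Q p' \<longrightarrow> p' \<in> span {p}" "p \<in> span {vector_derivative \<gamma> (at 0)}"
    have "dir (?T p)"
      unfolding dir using p(1,2) by blast
    moreover have "\<forall>w'. dir w' \<longrightarrow> w' \<in> span {?T p}"
      unfolding uniq by (rule p(3))
    moreover have "?T p \<in> span {vector_derivative (f \<circ> \<gamma>) (at 0)}"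
      unfolding tangent[OF \<gamma>] by (rule p(4))
    ultimately show "\<exists>\<gamma> w. regular_curve_near C q \<gamma> \<and> dir w \<and>
        (\<forall>w'. dir w' \<longrightarrow> w' \<in> span {w}) \<and> w \<in> span {vector_derivative (f \<circ> \<gamma>) (at 0)}"
      using \<gamma> by (intro exI[of _ \<gamma>] exI[of _ "?T p"] conjI) auto
  qed
qed

theorem theorem3p4:
  fixes \<alpha> :: "real \<times> real \<Rightarrow> real^3" and U :: "(real \<times> real) set"
    and S :: "(real^3) set" and q :: "real \<times> real"
  assumes "smooth_surface S"
    and "local_parametrization \<alpha> U S"
    and "parabolic_set \<alpha> U = {}"
    and "q \<in> U"
  shows "affine_cusp_of_Gauss \<alpha> U q \<longleftrightarrow> cusp_of_Gauss (conormal \<alpha>) U q"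
proof -
  interpret nonparabolic_chart \<alpha> U
    using assms(2,3) by unfold_locales (auto simp: local_parametrization_def parabolic_set_def)
  have "inj (frechet_derivative \<alpha> (at q))"
    using assms(2,4) by (simp add: local_parametrization_def)
  note \<alpha> = tangent_zero_direction_iff[OF smooth_on_differentiable[OF smooth assms(4)] this]
  \<comment> \<open>A zero cross product would force \<open>volume q = 0\<close>; hence \<nu> is an
    immersion at \<open>q\<close>, just as \<alpha> is.\<close>
  have "cross3 (du \<nu> q) (dv \<nu> q) \<noteq> 0"
    using volume_nonzero[OF assms(4)] by (auto simp: volume_def)
  with smooth_on_differentiable[OF smooth_conormal assms(4)]
  have "inj (frechet_derivative \<nu> (at q))"
    by (rule inj_frechet_derivative_if_cross3)
  note \<nu> = tangent_zero_direction_iff[OF smooth_on_differentiable[OF smooth_conormal assms(4)] this]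
  show ?thesis
    \<comment> \<open>With parabolic sets and zero conditions identified, pulling back along
      \<alpha> and along \<nu> leaves literally the same statement about parameter vectors.\<close>
    unfolding affine_cusp_of_Gauss_def cusp_of_Gauss_def affine_asymptotic_direction_def
      asymptotic_direction_def affine_parabolic_set_eq affine_third_form_eq_0_iff[OF assms(4)] \<alpha> \<nu>
    by (rule refl)
qed

end
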